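(* Let $n\ge1$, let $\phi:\mathbb R_+^n\to\mathbb R\cup\{+\infty\}$ be a convex function, let $\Lambda$ be an $n\times n$ real symmetric matrix and $\delta\in\mathbb R^n$. Suppose that the pair $(\Lambda,\delta)$ can be put in block-signed form. Then $$\inf_{w\in\mathbb R^n}\Big(w^\top\Lambda w+w^\top\delta+\phi(w_1^2,\dots,w_n^2)\Big)=\inf_{x\in\mathbb R_+^n}\Big(\widetilde q(x)+\phi(x)\Big),$$ where the right-hand side is a convex program: the function $\widetilde q:\mathbb R^n\to\mathbb R\cup\{+\infty\}$ defined by $\widetilde q(x)=+\infty$ if $x\notin\mathbb R_+^n$ and $$\widetilde q(x)=\sum_{i=1}^n\Lambda_{i,i}x_i-\sum_{i\ne j}|\Lambda_{i,j}|\sqrt{x_ix_j}-\sum_{i=1}^n|\delta_i|\sqrt{x_i}\quad\text{if }x\in\mathbb R_+^n$$ is proper convex lower semicontinuous with effective domain $\mathbb R_+^n$. Moreover, let $\varepsilon\in\{-1,1\}^n$ be the sign vector associated with the block-signed form. Then, if $x^*\in\operatorname{argmin}_{x\in\mathbb R_+^n}\big(\widetilde q(x)+\phi(x)\big)$, the vector $(\varepsilon_1\sqrt{x_1^*},\dots,\varepsilon_n\sqrt{x_n^*})$ belongs to $\operatorname{argmin}_{w\in\mathbb R^n}\big(w^\top\Lambda w+w^\top\delta+\phi(w_1^2,\dots,w_n^2)\big)$.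
   Context: Sums over $i\ne j$ range over ordered pairs in $\{1,\dots,n\}^2$ with $i\neq j$. A function with values in $[-\infty,+\infty]$ is convex if its epigraph is convex, proper if it never takes the value $-\infty$ and is not identically $+\infty$; its effective domain is the set where it is $<+\infty$. Block-signed form: the pair $(\Lambda,\delta)$ can be put in block-signed form if there exist (possibly empty) subsets $P,M\subset\{1,\dots,n\}$ with $P\cap M=\emptyset$, $P\cup M=\{1,\dots,n\}$ such that $\delta_i\ge 0$ for $i\in P$; $\delta_i\le 0$ for $i\in M$; $\Lambda_{i,j}\le 0$ for all $i\neq j$ both in $P$ and for all $i\ne j$ both in $M$; and $\Lambda_{i,j}\ge 0$ whenever one of $i,j$ is in $P$ and the other is in $M$ (diagonal entries are unrestricted). The associated sign vector $\varepsilon\in\{-1,1\}^n$ is $\varepsilon_i=-1$ for $i\in P$ and $\varepsilon_i=+1$ for $i\in M$. *)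

theory Defs
  imports "HOL-Analysis.Analysis"
begin

definition nonneg_orthant :: "(real ^ 'n) set" where
  "nonneg_orthant = {x. \<forall>i. 0 \<le> x $ i}"

text \<open>
  The library's \<open>epigraph\<close> and \<open>convex_on\<close> are restricted to real-valued functions;
  the following are their analogues for values in \<open>[-\<infinity>, +\<infinity>]\<close>. A function defined only
  on \<open>S\<close> is represented by a total one whose values outside \<open>S\<close> are ignored.
\<close>

definition ereal_epigraph :: "'a set \<Rightarrow> ('a \<Rightarrow> ereal) \<Rightarrow> ('a \<times> real) set" where
  "ereal_epigraph S f = {(x, t). x \<in> S \<and> f x \<le> ereal t}"

definition ereal_convex_on :: "'a::real_vector set \<Rightarrow> ('a \<Rightarrow> ereal) \<Rightarrow> bool" where
  "ereal_convex_on S f \<longleftrightarrow> convex (ereal_epigraph S f)"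

definition convex_program :: "'a::real_vector set \<Rightarrow> ('a \<Rightarrow> ereal) \<Rightarrow> bool" where
  "convex_program S f \<longleftrightarrow> convex S \<and> ereal_convex_on S f"

definition proper_fun :: "('a \<Rightarrow> ereal) \<Rightarrow> bool" where
  "proper_fun f \<longleftrightarrow> (\<forall>x. f x \<noteq> -\<infinity>) \<and> (\<exists>x. f x \<noteq> \<infinity>)"

definition effective_domain :: "('a \<Rightarrow> ereal) \<Rightarrow> 'a set" where
  "effective_domain f = {x. f x < \<infinity>}"

definition lower_semicontinuous :: "('a::topological_space \<Rightarrow> ereal) \<Rightarrow> bool" where
  "lower_semicontinuous f \<longleftrightarrow> (\<forall>x. f x \<le> Liminf (at x) f)"

definition block_signed_form ::
  "real ^ 'n ^ 'n \<Rightarrow> real ^ 'n \<Rightarrow> 'n set \<Rightarrow> 'n set \<Rightarrow> bool" where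
  "block_signed_form \<Lambda> \<delta> P M \<longleftrightarrow>
     P \<inter> M = {} \<and> P \<union> M = UNIV \<and>
     (\<forall>i\<in>P. \<delta> $ i \<ge> 0) \<and> (\<forall>i\<in>M. \<delta> $ i \<le> 0) \<and>
     (\<forall>i\<in>P. \<forall>j\<in>P. i \<noteq> j \<longrightarrow> \<Lambda> $ i $ j \<le> 0) \<and>
     (\<forall>i\<in>M. \<forall>j\<in>M. i \<noteq> j \<longrightarrow> \<Lambda> $ i $ j \<le> 0) \<and>
     (\<forall>i\<in>P. \<forall>j\<in>M. \<Lambda> $ i $ j \<ge> 0 \<and> \<Lambda> $ j $ i \<ge> 0)"

text \<open>In a block-signed form \<open>M\<close> is the complement of \<open>P\<close>, so \<open>P\<close> determines the signs.\<close>

definition sign_vector :: "'n set \<Rightarrow> real ^ 'n" where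
  "sign_vector P = (\<chi> i. if i \<in> P then -1 else 1)"

definition q_tilde :: "real ^ 'n ^ 'n \<Rightarrow> real ^ 'n \<Rightarrow> real ^ 'n \<Rightarrow> ereal" where
  "q_tilde \<Lambda> \<delta> x =
     (if x \<in> nonneg_orthant
      then ereal ((\<Sum>i\<in>UNIV. \<Lambda> $ i $ i * x $ i)
                  - (\<Sum>(i, j)\<in>{(i, j). i \<noteq> j}. \<bar>\<Lambda> $ i $ j\<bar> * sqrt (x $ i * x $ j))
                  - (\<Sum>i\<in>UNIV. \<bar>\<delta> $ i\<bar> * sqrt (x $ i)))
      else \<infinity>)"

definition quad_objective ::
  "real ^ 'n ^ 'n \<Rightarrow> real ^ 'n \<Rightarrow> (real ^ 'n \<Rightarrow> ereal) \<Rightarrow> real ^ 'n \<Rightarrow> ereal" where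
  "quad_objective \<Lambda> \<delta> \<phi> w =
     ereal (w \<bullet> (\<Lambda> *v w) + w \<bullet> \<delta>) + \<phi> (\<chi> i. (w $ i)\<^sup>2)"

end

theory Submission
  imports Defs
begin

text \<open>
  The substitution \<open>x\<^sub>i = w\<^sub>i\<^sup>2\<close> turns every off-diagonal term \<open>\<Lambda>\<^sub>i\<^sub>j w\<^sub>i w\<^sub>j\<close> into something at
  least \<open>-\<bar>\<Lambda>\<^sub>i\<^sub>j\<bar> sqrt (x\<^sub>i x\<^sub>j)\<close> and every linear term into something at least
  \<open>-\<bar>\<delta>\<^sub>i\<bar> sqrt x\<^sub>i\<close>; the block-signed form says precisely that the single choice of signs
  \<open>w = \<epsilon> sqrt x\<close> attains all these bounds at once. The relaxation is convex because geometric
  means are concave.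
\<close>

text \<open>The finite formula is kept apart from the value \<open>\<infinity>\<close> outside the
  orthant, so that the real-valued notions of convexity and continuity apply. As \<open>sqrt\<close>
  is total and continuous on the reals, it is continuous on the whole space.\<close>

definition relaxed_objective :: "real ^ 'n ^ 'n \<Rightarrow> real ^ 'n \<Rightarrow> real ^ 'n \<Rightarrow> real" where
  "relaxed_objective \<Lambda> \<delta> x = (\<Sum>i\<in>UNIV. \<Lambda> $ i $ i * x $ i)
     - (\<Sum>(i, j)\<in>{(i, j). i \<noteq> j}. \<bar>\<Lambda> $ i $ j\<bar> * sqrt (x $ i * x $ j))
     - (\<Sum>i\<in>UNIV. \<bar>\<delta> $ i\<bar> * sqrt (x $ i))"

lemma q_tilde_eq:
  "q_tilde \<Lambda> \<delta> x = (if x \<in> nonneg_orthant then ereal (relaxed_objective \<Lambda> \<delta> x) else \<infinity>)"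
  by (simp add: q_tilde_def relaxed_objective_def)

section \<open>Concavity of geometric means and convexity of the relaxation\<close>

lemma convex_nonneg_orthant: "convex (nonneg_orthant :: (real ^ 'n) set)"
  by (rule convexI) (auto simp: nonneg_orthant_def)

lemma closed_nonneg_orthant: "closed (nonneg_orthant :: (real ^ 'n) set)"
  unfolding nonneg_orthant_def
  by (intro closed_Collect_all closed_Collect_le continuous_intros)

text \<open>Cauchy-Schwarz in the plane for \<open>(sqrt a, sqrt c)\<close> and
  \<open>(sqrt b, sqrt d)\<close>. After squaring, it remains to bound the cross term
  \<open>2 * sqrt (a * b * c * d)\<close> by \<open>a * d + c * b\<close>, which is the AM-GM
  inequality.\<close>

lemma sqrt_mult_superadditive:
  fixes a b c d :: real
  assumes "0 \<le> a" "0 \<le> b" "0 \<le> c" "0 \<le> d"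
  shows "sqrt (a * b) + sqrt (c * d) \<le> sqrt ((a + c) * (b + d))"
proof (rule real_le_rsqrt)
  have "2 * (sqrt (a * d) * sqrt (c * b)) \<le> (sqrt (a * d))\<^sup>2 + (sqrt (c * b))\<^sup>2"
    using sum_squares_bound[of "sqrt (a * d)" "sqrt (c * b)"] by simp
  moreover have "sqrt (a * d) * sqrt (c * b) = sqrt (a * b) * sqrt (c * d)"
    by (simp add: real_sqrt_mult)
  ultimately show "(sqrt (a * b) + sqrt (c * d))\<^sup>2 \<le> (a + c) * (b + d)"
    using assms by (simp add: power2_sum algebra_simps)
qed

text \<open>The geometric mean is homogeneous of degree one, so the weights move under the roots and
  superadditivity becomes concavity.\<close>

lemma sqrt_mult_concave:
  fixes a b c d u v :: real
  assumes "0 \<le> a" "0 \<le> b" "0 \<le> c" "0 \<le> d" "0 \<le> u" "0 \<le> v"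
  shows "u * sqrt (a * b) + v * sqrt (c * d) \<le> sqrt ((u * a + v * c) * (u * b + v * d))"
proof -
  have "u * sqrt (a * b) = sqrt ((u * a) * (u * b))" "v * sqrt (c * d) = sqrt ((v * c) * (v * d))"
    using assms by (simp_all add: real_sqrt_mult)
  then show ?thesis
    using sqrt_mult_superadditive[of "u * a" "u * b" "v * c" "v * d"] assms by simp
qed

lemma convex_on_relaxed_objective:
  fixes \<Lambda> :: "real ^ 'n ^ 'n"
  shows "convex_on nonneg_orthant (relaxed_objective \<Lambda> \<delta>)"
proof (rule convex_onI)
  fix t :: real and x y :: "real ^ 'n"
  assume t: "0 < t" "t < 1" and xy: "x \<in> nonneg_orthant" "y \<in> nonneg_orthant"
  define z where "z = (1 - t) *\<^sub>R x + t *\<^sub>R y"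
  have z: "z $ i = (1 - t) * x $ i + t * y $ i" for i
    by (simp add: z_def)
  have nn: "0 \<le> x $ i" "0 \<le> y $ i" for i
    using xy by (auto simp: nonneg_orthant_def)
  have gm: "(1 - t) * sqrt (x $ i * x $ j) + t * sqrt (y $ i * y $ j) \<le> sqrt (z $ i * z $ j)" for i j
    unfolding z by (rule sqrt_mult_concave) (use nn t in auto)
  \<comment> \<open>A single square root is the geometric mean with the constant \<open>1\<close>;
    the weights \<open>1 - t\<close> and \<open>t\<close> sum to one, so the second factor stays
    \<open>1\<close>.\<close>
  have sq: "(1 - t) * sqrt (x $ i) + t * sqrt (y $ i) \<le> sqrt (z $ i)" for i
    using sqrt_mult_concave[of "x $ i" 1 "y $ i" 1 "1 - t" t] nn t by (simp add: z)
  have 1: "(\<Sum>i\<in>UNIV. \<Lambda> $ i $ i * z $ i)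
      = (1 - t) * (\<Sum>i\<in>UNIV. \<Lambda> $ i $ i * x $ i) + t * (\<Sum>i\<in>UNIV. \<Lambda> $ i $ i * y $ i)"
    unfolding sum_distrib_left sum.distrib[symmetric]
    by (rule sum.cong) (simp_all add: z algebra_simps)
  have 2: "(1 - t) * (\<Sum>(i, j)\<in>{(i, j). i \<noteq> j}. \<bar>\<Lambda> $ i $ j\<bar> * sqrt (x $ i * x $ j))
      + t * (\<Sum>(i, j)\<in>{(i, j). i \<noteq> j}. \<bar>\<Lambda> $ i $ j\<bar> * sqrt (y $ i * y $ j))
      \<le> (\<Sum>(i, j)\<in>{(i, j). i \<noteq> j}. \<bar>\<Lambda> $ i $ j\<bar> * sqrt (z $ i * z $ j))"
    unfolding sum_distrib_left sum.distrib[symmetric]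
  proof (rule sum_mono, clarify)
    fix i j
    show "(1 - t) * (\<bar>\<Lambda> $ i $ j\<bar> * sqrt (x $ i * x $ j)) + t * (\<bar>\<Lambda> $ i $ j\<bar> * sqrt (y $ i * y $ j))
        \<le> \<bar>\<Lambda> $ i $ j\<bar> * sqrt (z $ i * z $ j)"
      using mult_left_mono[OF gm[of i j], of "\<bar>\<Lambda> $ i $ j\<bar>"] by (simp add: algebra_simps)
  qed
  have 3: "(1 - t) * (\<Sum>i\<in>UNIV. \<bar>\<delta> $ i\<bar> * sqrt (x $ i)) + t * (\<Sum>i\<in>UNIV. \<bar>\<delta> $ i\<bar> * sqrt (y $ i))
      \<le> (\<Sum>i\<in>UNIV. \<bar>\<delta> $ i\<bar> * sqrt (z $ i))"
    unfolding sum_distrib_left sum.distrib[symmetric]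
  proof (rule sum_mono)
    fix i
    show "(1 - t) * (\<bar>\<delta> $ i\<bar> * sqrt (x $ i)) + t * (\<bar>\<delta> $ i\<bar> * sqrt (y $ i))
        \<le> \<bar>\<delta> $ i\<bar> * sqrt (z $ i)"
      using mult_left_mono[OF sq[of i], of "\<bar>\<delta> $ i\<bar>"] by (simp add: algebra_simps)
  qed
  have "relaxed_objective \<Lambda> \<delta> z
      \<le> (1 - t) * relaxed_objective \<Lambda> \<delta> x + t * relaxed_objective \<Lambda> \<delta> y"
    unfolding relaxed_objective_def right_diff_distrib using 1 2 3 by linarith
  then show "relaxed_objective \<Lambda> \<delta> ((1 - t) *\<^sub>R x + t *\<^sub>R y)
      \<le> (1 - t) * relaxed_objective \<Lambda> \<delta> x + t * relaxed_objective \<Lambda> \<delta> y"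
    by (simp add: z_def)
qed (rule convex_nonneg_orthant)

section \<open>Convexity of extended-valued functions\<close>

text \<open>A finite summand can be moved across an inequality: \<open>(x, s)\<close> lies in the
  epigraph of the sum exactly when \<open>(x, s - g x)\<close> lies in that of \<open>f\<close>.
  Points are lowered by \<open>g\<close>, combined in the epigraph of \<open>f\<close>, and raised
  again.\<close>

lemma ereal_convex_on_add_real:
  assumes "convex_on S g" and "ereal_convex_on S f"
  shows "ereal_convex_on S (\<lambda>x. ereal (g x) + f x)"
  unfolding ereal_convex_on_def
proof (rule convexI)
  \<comment> \<open>Only \<open>b\<close> may be infinite here, so no indeterminate sum
    arises.\<close>
  have shift: "ereal a + b \<le> ereal c \<longleftrightarrow> b \<le> ereal (c - a)" for a b c
    by (cases b) auto
  fix p q :: "'a \<times> real" and u v :: real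
  assume p: "p \<in> ereal_epigraph S (\<lambda>x. ereal (g x) + f x)"
    and q: "q \<in> ereal_epigraph S (\<lambda>x. ereal (g x) + f x)"
    and uv: "0 \<le> u" "0 \<le> v" "u + v = 1"
  obtain x s y t where pq: "p = (x, s)" "q = (y, t)"
    by (metis surj_pair)
  have xy: "x \<in> S" "y \<in> S" "(x, s - g x) \<in> ereal_epigraph S f" "(y, t - g y) \<in> ereal_epigraph S f"
    using p q by (auto simp: pq ereal_epigraph_def shift)
  have "u *\<^sub>R (x, s - g x) + v *\<^sub>R (y, t - g y) \<in> ereal_epigraph S f"
    using assms(2) xy(3,4) uv unfolding ereal_convex_on_def by (rule convexD)
  then have z: "u *\<^sub>R x + v *\<^sub>R y \<in> S"
      "f (u *\<^sub>R x + v *\<^sub>R y) \<le> ereal (u * (s - g x) + v * (t - g y))"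
    by (auto simp: ereal_epigraph_def)
  \<comment> \<open>Convexity of \<open>g\<close> ensures that raising the combined point by
    \<open>g\<close> at the new position does not overshoot the height
    \<open>u * s + v * t\<close>.\<close>
  have "g (u *\<^sub>R x + v *\<^sub>R y) \<le> u * g x + v * g y"
    using assms(1) xy(1,2) uv by (simp add: convex_on_def)
  then have "u * (s - g x) + v * (t - g y) \<le> u * s + v * t - g (u *\<^sub>R x + v *\<^sub>R y)"
    by (simp add: algebra_simps)
  then have "f (u *\<^sub>R x + v *\<^sub>R y) \<le> ereal (u * s + v * t - g (u *\<^sub>R x + v *\<^sub>R y))"
    using z(2) by (meson ereal_less_eq(3) order_trans)
  then show "u *\<^sub>R p + v *\<^sub>R q \<in> ereal_epigraph S (\<lambda>x. ereal (g x) + f x)"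
    using z(1) by (simp add: pq ereal_epigraph_def shift)
qed

text \<open>As a congruence rule, this lets the simplifier assume membership in \<open>S\<close> and
  thereby resolve the case distinction in \<open>q_tilde\<close>.\<close>

lemma ereal_convex_on_cong:
  "(\<And>x. x \<in> S \<Longrightarrow> f x = g x) \<Longrightarrow> ereal_convex_on S f = ereal_convex_on S g"
  unfolding ereal_convex_on_def ereal_epigraph_def
  by (rule arg_cong[where f = convex]) auto

lemma ereal_convex_on_UNIV_q_tilde:
  fixes \<Lambda> :: "real ^ 'n ^ 'n"
  shows "ereal_convex_on UNIV (q_tilde \<Lambda> \<delta>)"
proof -
  \<comment> \<open>The zero function serves as the extended-valued summand, turning real convexity
    of the formula into convexity of its epigraph.\<close>
  have "ereal_convex_on (nonneg_orthant :: (real ^ 'n) set) (\<lambda>x. 0)"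
  proof -
    have "ereal_epigraph nonneg_orthant (\<lambda>x. 0) = (nonneg_orthant :: (real ^ 'n) set) \<times> {0..}"
      by (auto simp: ereal_epigraph_def)
    then show ?thesis
      by (simp add: ereal_convex_on_def convex_Times convex_nonneg_orthant)
  qed
  from ereal_convex_on_add_real[OF convex_on_relaxed_objective[of \<Lambda> \<delta>] this]
  have "ereal_convex_on nonneg_orthant (\<lambda>x. ereal (relaxed_objective \<Lambda> \<delta> x))"
    by simp
  \<comment> \<open>Points outside the orthant have value \<open>\<infinity>\<close> and contribute
    nothing to the epigraph.\<close>
  moreover have "ereal_epigraph UNIV (q_tilde \<Lambda> \<delta>)
      = ereal_epigraph nonneg_orthant (\<lambda>x. ereal (relaxed_objective \<Lambda> \<delta> x))"
    by (auto simp: ereal_epigraph_def q_tilde_eq split: if_splits)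
  ultimately show ?thesis
    by (simp add: ereal_convex_on_def)
qed

lemma convex_program_q_tilde_add:
  assumes "ereal_convex_on nonneg_orthant \<phi>"
  shows "convex_program nonneg_orthant (\<lambda>x. q_tilde \<Lambda> \<delta> x + \<phi> x)"
  unfolding convex_program_def
  using convex_nonneg_orthant ereal_convex_on_add_real[OF convex_on_relaxed_objective assms]
  by (simp add: q_tilde_eq cong: ereal_convex_on_cong)

text \<open>At a point of \<open>S\<close> the extension dominates the continuous \<open>g\<close>,
  with equality at the point itself. Off \<open>S\<close>, openness of the complement makes the
  extension equal to \<open>\<infinity>\<close> nearby.\<close>

lemma lower_semicontinuous_extend_top:
  fixes g :: "'a::topological_space \<Rightarrow> real"
  assumes S: "closed S" and g: "continuous_on UNIV g"
  shows "lower_semicontinuous (\<lambda>x. if x \<in> S then ereal (g x) else \<infinity>)" (is "lower_semicontinuous ?f")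
  unfolding lower_semicontinuous_def
proof
  fix x
  show "?f x \<le> Liminf (at x) ?f"
  \<comment> \<open>At an isolated point the filter is trivial and its \<open>Liminf\<close> is the
    top element; elsewhere limits determine the \<open>Liminf\<close>.\<close>
  proof (cases "at x = bot")
    case True
    then show ?thesis by simp
  next
    case False
    show ?thesis
    proof (cases "x \<in> S")
      case True
      have "((\<lambda>y. ereal (g y)) \<longlongrightarrow> ereal (g x)) (at x)"
        using g by (simp add: continuous_on_def)
      then have "Liminf (at x) (\<lambda>y. ereal (g y)) = ereal (g x)"
        using False by (intro lim_imp_Liminf)
      moreover have "Liminf (at x) (\<lambda>y. ereal (g y)) \<le> Liminf (at x) ?f"
        by (rule Liminf_mono) simp
      ultimately show ?thesis
        using True by simp
    next
      case out: False
      have "eventually (\<lambda>y. y \<in> - S) (at x)"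
        using S out by (intro eventually_at_in_open') auto
      then have "eventually (\<lambda>y. \<infinity> \<le> ?f y) (at x)"
        by eventually_elim simp
      then have "\<infinity> \<le> Liminf (at x) ?f"
        by (rule Liminf_bounded)
      then show ?thesis by simp
    qed
  qed
qed

lemma continuous_on_relaxed_objective: "continuous_on A (relaxed_objective \<Lambda> \<delta>)"
  unfolding relaxed_objective_def case_prod_unfold by (intro continuous_intros)

lemma lower_semicontinuous_q_tilde: "lower_semicontinuous (q_tilde \<Lambda> \<delta>)"
  using lower_semicontinuous_extend_top[OF closed_nonneg_orthant continuous_on_relaxed_objective]
  by (simp add: q_tilde_eq[abs_def])

section \<open>Comparing the quadratic with its relaxation\<close>

lemma quadratic_form_split:
  fixes \<Lambda> :: "real ^ 'n ^ 'n"
  shows "w \<bullet> (\<Lambda> *v w) = (\<Sum>i\<in>UNIV. \<Lambda> $ i $ i * (w $ i)\<^sup>2)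
    + (\<Sum>(i, j)\<in>{(i, j). i \<noteq> j}. \<Lambda> $ i $ j * (w $ i * w $ j))"
proof -
  let ?h = "\<lambda>(i, j). \<Lambda> $ i $ j * (w $ i * w $ j)"
  have "w \<bullet> (\<Lambda> *v w) = (\<Sum>i\<in>UNIV. \<Sum>j\<in>UNIV. ?h (i, j))"
    by (simp add: inner_vec_def matrix_vector_mult_def sum_distrib_left algebra_simps)
  also have "\<dots> = sum ?h (UNIV \<times> UNIV)"
    by (simp add: sum.cartesian_product)
  also have "UNIV \<times> UNIV = range (\<lambda>i::'n. (i, i)) \<union> {(i, j). i \<noteq> j}"
    by auto
  also have "sum ?h \<dots> = sum ?h (range (\<lambda>i. (i, i))) + sum ?h {(i, j). i \<noteq> j}"
    by (rule sum.union_disjoint) auto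
  also have "sum ?h (range (\<lambda>i. (i, i))) = (\<Sum>i\<in>UNIV. \<Lambda> $ i $ i * (w $ i)\<^sup>2)"
    by (subst sum.reindex) (auto simp: inj_on_def power2_eq_square)
  finally show ?thesis .
qed

text \<open>Termwise, since \<open>sqrt\<close> of a square is an absolute value and
  \<open>a * b\<close> is at least \<open>- (\<bar>a\<bar> * \<bar>b\<bar>)\<close>.\<close>

lemma relaxed_objective_le_quadratic:
  "relaxed_objective \<Lambda> \<delta> (\<chi> i. (w $ i)\<^sup>2) \<le> w \<bullet> (\<Lambda> *v w) + w \<bullet> \<delta>"
proof -
  have bound: "- (\<bar>a\<bar> * \<bar>b\<bar>) \<le> a * b" for a b :: real
    using abs_ge_minus_self[of "a * b"] by (simp add: abs_mult)
  have "- (\<Sum>(i, j)\<in>{(i, j). i \<noteq> j}. \<bar>\<Lambda> $ i $ j\<bar> * sqrt ((w $ i)\<^sup>2 * (w $ j)\<^sup>2))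
      \<le> (\<Sum>(i, j)\<in>{(i, j). i \<noteq> j}. \<Lambda> $ i $ j * (w $ i * w $ j))"
    unfolding sum_negf[symmetric]
  proof (rule sum_mono, clarify)
    fix i j
    show "- (\<bar>\<Lambda> $ i $ j\<bar> * sqrt ((w $ i)\<^sup>2 * (w $ j)\<^sup>2)) \<le> \<Lambda> $ i $ j * (w $ i * w $ j)"
      using bound[of "\<Lambda> $ i $ j" "w $ i * w $ j"] by (simp add: real_sqrt_mult abs_mult)
  qed
  moreover have "- (\<Sum>i\<in>UNIV. \<bar>\<delta> $ i\<bar> * sqrt ((w $ i)\<^sup>2)) \<le> w \<bullet> \<delta>"
    unfolding sum_negf[symmetric] inner_vec_def
    by (rule sum_mono) (use bound in \<open>simp add: mult.commute\<close>)
  ultimately show ?thesis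
    unfolding relaxed_objective_def quadratic_form_split by simp
qed

text \<open>Each termwise bound is attained: two signs agree within a block, where
  \<open>\<Lambda> $ i $ j \<le> 0\<close>, and differ across blocks, where
  \<open>\<Lambda> $ i $ j \<ge> 0\<close>. Each sign is also opposite to that of a nonzero
  \<open>\<delta> $ i\<close>.\<close>

lemma quadratic_signed_sqrt:
  assumes B: "block_signed_form \<Lambda> \<delta> P M" and x: "x \<in> nonneg_orthant"
  defines "w \<equiv> (\<chi> i. sign_vector P $ i * sqrt (x $ i))"
  shows "w \<bullet> (\<Lambda> *v w) + w \<bullet> \<delta> = relaxed_objective \<Lambda> \<delta> x"
    and "(\<chi> i. (w $ i)\<^sup>2) = x"
proof -
  have nn: "0 \<le> x $ i" for i
    using x by (simp add: nonneg_orthant_def)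
  have disj: "P \<inter> M = {}" "P \<union> M = UNIV"
    and blocks: "\<And>i. i \<in> P \<Longrightarrow> \<delta> $ i \<ge> 0" "\<And>i. i \<in> M \<Longrightarrow> \<delta> $ i \<le> 0"
      "\<And>i j. i \<in> P \<Longrightarrow> j \<in> P \<Longrightarrow> i \<noteq> j \<Longrightarrow> \<Lambda> $ i $ j \<le> 0"
      "\<And>i j. i \<in> M \<Longrightarrow> j \<in> M \<Longrightarrow> i \<noteq> j \<Longrightarrow> \<Lambda> $ i $ j \<le> 0"
      "\<And>i j. i \<in> P \<Longrightarrow> j \<in> M \<Longrightarrow> \<Lambda> $ i $ j \<ge> 0"
      "\<And>i j. i \<in> P \<Longrightarrow> j \<in> M \<Longrightarrow> \<Lambda> $ j $ i \<ge> 0"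
    using B by (simp_all add: block_signed_form_def)
  have M: "i \<in> M \<longleftrightarrow> i \<notin> P" for i
    using disj by auto
  have w: "w $ i = (if i \<in> P then - sqrt (x $ i) else sqrt (x $ i))" for i
    by (simp add: w_def sign_vector_def)
  have off: "\<Lambda> $ i $ j * (w $ i * w $ j) = - (\<bar>\<Lambda> $ i $ j\<bar> * sqrt (x $ i * x $ j))" if "i \<noteq> j" for i j
  proof -
    have "\<Lambda> $ i $ j \<le> 0" if "i \<in> P \<longleftrightarrow> j \<in> P"
      using blocks(3)[of i j] blocks(4)[of i j] that \<open>i \<noteq> j\<close> by (auto simp: M)
    \<comment> \<open>A pair across the blocks occurs in two orientations, each covered by one of
      the two cross-block conditions.\<close>
    moreover have "\<Lambda> $ i $ j \<ge> 0" if "i \<in> P \<longleftrightarrow> j \<notin> P"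
      using blocks(5)[of i j] blocks(6)[of j i] that by (auto simp: M)
    ultimately show ?thesis
      by (auto simp: w real_sqrt_mult)
  qed
  have lin: "w $ i * \<delta> $ i = - (\<bar>\<delta> $ i\<bar> * sqrt (x $ i))" for i
  proof -
    have "if i \<in> P then \<delta> $ i \<ge> 0 else \<delta> $ i \<le> 0"
      using blocks(1,2) by (simp add: M)
    then show ?thesis
      by (auto simp: w split: if_splits)
  qed
  have sq: "(w $ i)\<^sup>2 = x $ i" for i
    using nn by (simp add: w)
  then show "(\<chi> i. (w $ i)\<^sup>2) = x"
    by (simp add: vec_eq_iff)
  have "(\<Sum>(i, j)\<in>{(i, j). i \<noteq> j}. \<Lambda> $ i $ j * (w $ i * w $ j))
      = - (\<Sum>(i, j)\<in>{(i, j). i \<noteq> j}. \<bar>\<Lambda> $ i $ j\<bar> * sqrt (x $ i * x $ j))"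
    unfolding sum_negf[symmetric] by (rule sum.cong) (auto simp: off)
  moreover have "w \<bullet> \<delta> = - (\<Sum>i\<in>UNIV. \<bar>\<delta> $ i\<bar> * sqrt (x $ i))"
    by (simp add: inner_vec_def lin sum_negf)
  ultimately show "w \<bullet> (\<Lambda> *v w) + w \<bullet> \<delta> = relaxed_objective \<Lambda> \<delta> x"
    unfolding relaxed_objective_def quadratic_form_split by (simp add: sq)
qed

lemma squares_in_nonneg_orthant: "(\<chi> i. (w $ i)\<^sup>2) \<in> nonneg_orthant"
  by (simp add: nonneg_orthant_def)

text \<open>Passing from \<open>w\<close> to its squares never raises the value, which gives one
  inequality between the infima.\<close>

lemma relaxation_le_quad_objective:
  "q_tilde \<Lambda> \<delta> (\<chi> i. (w $ i)\<^sup>2) + \<phi> (\<chi> i. (w $ i)\<^sup>2) \<le> quad_objective \<Lambda> \<delta> \<phi> w"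
  unfolding quad_objective_def q_tilde_eq
  using squares_in_nonneg_orthant[of w] relaxed_objective_le_quadratic[of \<Lambda> \<delta> w]
  by (intro add_right_mono) simp

text \<open>Conversely, every feasible value of the relaxed program is attained in the original
  problem. This yields the other inequality and transfers minimizers.\<close>

lemma quad_objective_signed_sqrt:
  assumes "block_signed_form \<Lambda> \<delta> P M" and "x \<in> nonneg_orthant"
  shows "quad_objective \<Lambda> \<delta> \<phi> (\<chi> i. sign_vector P $ i * sqrt (x $ i)) = q_tilde \<Lambda> \<delta> x + \<phi> x"
  unfolding quad_objective_def q_tilde_eq
  using quadratic_signed_sqrt[OF assms] assms(2) by simp

theorem theorem23:
  fixes \<phi> :: "real ^ 'n \<Rightarrow> ereal" and \<Lambda> :: "real ^ 'n ^ 'n" and \<delta> :: "real ^ 'n"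
  assumes phi_range: "\<forall>x\<in>nonneg_orthant. \<phi> x \<noteq> -\<infinity>"
    and phi_convex: "ereal_convex_on nonneg_orthant \<phi>"
    and symmetric: "transpose \<Lambda> = \<Lambda>"
    and block_signed: "\<exists>P M. block_signed_form \<Lambda> \<delta> P M"
  shows "(INF w. quad_objective \<Lambda> \<delta> \<phi> w) = (INF x\<in>nonneg_orthant. q_tilde \<Lambda> \<delta> x + \<phi> x)
    \<and> convex_program nonneg_orthant (\<lambda>x. q_tilde \<Lambda> \<delta> x + \<phi> x)
    \<and> proper_fun (q_tilde \<Lambda> \<delta>)
    \<and> ereal_convex_on UNIV (q_tilde \<Lambda> \<delta>)
    \<and> lower_semicontinuous (q_tilde \<Lambda> \<delta>)
    \<and> effective_domain (q_tilde \<Lambda> \<delta>) = nonneg_orthant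
    \<and> (\<forall>P M xs. block_signed_form \<Lambda> \<delta> P M \<longrightarrow>
         is_arg_min (\<lambda>x. q_tilde \<Lambda> \<delta> x + \<phi> x) (\<lambda>x. x \<in> nonneg_orthant) xs \<longrightarrow>
         is_arg_min (quad_objective \<Lambda> \<delta> \<phi>) (\<lambda>w. w \<in> UNIV)
           (\<chi> i. sign_vector P $ i * sqrt (xs $ i)))"
proof (intro conjI allI impI)
  show "(INF w. quad_objective \<Lambda> \<delta> \<phi> w) = (INF x\<in>nonneg_orthant. q_tilde \<Lambda> \<delta> x + \<phi> x)"
  proof (rule antisym)
    obtain P M where B: "block_signed_form \<Lambda> \<delta> P M"
      using block_signed by blast
    show "(INF w. quad_objective \<Lambda> \<delta> \<phi> w) \<le> (INF x\<in>nonneg_orthant. q_tilde \<Lambda> \<delta> x + \<phi> x)"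
      by (rule INF_greatest, subst quad_objective_signed_sqrt[OF B, symmetric]) (auto intro: INF_lower)
    show "(INF x\<in>nonneg_orthant. q_tilde \<Lambda> \<delta> x + \<phi> x) \<le> (INF w. quad_objective \<Lambda> \<delta> \<phi> w)"
      by (rule INF_mono) (use squares_in_nonneg_orthant relaxation_le_quad_objective in blast)
  qed
  show "convex_program nonneg_orthant (\<lambda>x. q_tilde \<Lambda> \<delta> x + \<phi> x)"
    using phi_convex by (rule convex_program_q_tilde_add)
  have "0 \<in> (nonneg_orthant :: (real ^ 'n) set)"
    by (simp add: nonneg_orthant_def)
  \<comment> \<open>The origin witnesses a finite value.\<close>
  then show "proper_fun (q_tilde \<Lambda> \<delta>)"
    unfolding proper_fun_def q_tilde_eq by (auto intro!: exI[of _ 0])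
  show "ereal_convex_on UNIV (q_tilde \<Lambda> \<delta>)"
    by (rule ereal_convex_on_UNIV_q_tilde)
  show "lower_semicontinuous (q_tilde \<Lambda> \<delta>)"
    by (rule lower_semicontinuous_q_tilde)
  show "effective_domain (q_tilde \<Lambda> \<delta>) = nonneg_orthant"
    by (auto simp: effective_domain_def q_tilde_eq split: if_splits)
next
  \<comment> \<open>The decomposition is arbitrary here, so the recovery of minimizers holds for the
    sign vector of every block-signed form.\<close>
  fix P M xs
  assume B: "block_signed_form \<Lambda> \<delta> P M"
    and xs: "is_arg_min (\<lambda>x. q_tilde \<Lambda> \<delta> x + \<phi> x) (\<lambda>x. x \<in> nonneg_orthant) xs"
  let ?w = "\<chi> i. sign_vector P $ i * sqrt (xs $ i)"
  have "quad_objective \<Lambda> \<delta> \<phi> ?w \<le> quad_objective \<Lambda> \<delta> \<phi> v" for v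
  proof -
    have "quad_objective \<Lambda> \<delta> \<phi> ?w = q_tilde \<Lambda> \<delta> xs + \<phi> xs"
      using B xs by (intro quad_objective_signed_sqrt) (auto simp: is_arg_min_def)
    \<comment> \<open>Minimality of \<open>xs\<close> is tested against the squares of the
      competitor \<open>v\<close>, a feasible point of the relaxed program.\<close>
    also have "\<dots> \<le> q_tilde \<Lambda> \<delta> (\<chi> i. (v $ i)\<^sup>2) + \<phi> (\<chi> i. (v $ i)\<^sup>2)"
      using xs squares_in_nonneg_orthant[of v] by (simp add: is_arg_min_linorder)
    also have "\<dots> \<le> quad_objective \<Lambda> \<delta> \<phi> v"
      by (rule relaxation_le_quad_objective)
    finally show ?thesis .
  qed
  then show "is_arg_min (quad_objective \<Lambda> \<delta> \<phi>) (\<lambda>w. w \<in> UNIV) ?w"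
    by (simp add: is_arg_min_linorder)
qed

end
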